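(* Let $q\ge 2$ be an integer and let $(b_1,\dots,b_{q-1})\in\{0,1,\dots,255\}^{q-1}$ be integers with $\sum_{1\le j<q}b_j^2\equiv 1 \pmod 4$. Consider the rational numbers $$a_0=\frac{1-\sum_{1\le j<q}b_j^2}{1+\sum_{1\le j<q}b_j^2},\qquad a_k=\frac{2b_k}{1+\sum_{1\le j<q}b_j^2}\quad (1\le k<q).$$ Then, written in lowest terms, $a_0,a_1,\dots,a_{q-1}$ all have odd denominators, and the numerator of $a_0$ is even. Consequently, $a_0,\dots,a_{q-1}$ define elements of $\mathbb{Z}/256\mathbb{Z}$ (still denoted by the same letters), for each $\varepsilon\in\{1,-1\}$ the element $1+\varepsilon a_0$ is a unit of $\mathbb{Z}/256\mathbb{Z}$, and, with $\mathsf{L}=(a_1\ a_2\ \cdots\ a_{q-1})$, the matrix $$\mathsf{U}_\varepsilon=\begin{pmatrix} a_0 & \mathsf{L}\\ -\varepsilon\,{}^{\mathsf t}\mathsf{L} & \mathsf{I}-(1+\varepsilon a_0)^{-1}\,{}^{\mathsf t}\mathsf{L}\,\mathsf{L}\end{pmatrix}$$ is a well-defined $q\times q$ matrix over $\mathbb{Z}/256\mathbb{Z}$ satisfying ${}^{\mathsf t}\mathsf{U}_\varepsilon\,\mathsf{U}_\varepsilon=\mathsf{I}$.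
   Context: A rational number with odd denominator is viewed as an element of $\mathbb{Z}/256\mathbb{Z}$ via the canonical ring homomorphism $\mathbb{Z}_{(2)}\to\mathbb{Z}/256\mathbb{Z}$, i.e. $r/s\mapsto r s^{-1}$ for $s$ odd. ${}^{\mathsf t}\mathsf{M}$ denotes the transpose of $\mathsf{M}$ and $\mathsf{I}$ the identity matrix of the appropriate size. *)

theory Defs
  imports
    "HOL-Library.Numeral_Type"
    "HOL-Number_Theory.Cong"
    "Jordan_Normal_Form.Matrix"
begin

text \<open>
  The ring of integers modulo 256 is the type \<open>256\<close> of \<open>HOL-Library.Numeral_Type\<close>, whose arithmetic
  is arithmetic modulo its cardinality. That type has no division, hence the following operation.
\<close>

definition unit_inv :: "'a::comm_ring_1 \<Rightarrow> 'a" where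
  "unit_inv x = (THE y. x * y = 1)"

lemma unit_inv_unique:
  assumes "x * y = 1"
  shows "unit_inv x = y"
  unfolding unit_inv_def
proof (rule the_equality)
  fix z
  assume "x * z = 1"
  then have "y = y * (x * z)" by simp
  also have "\<dots> = (x * y) * z" by (simp add: ac_simps)
  finally show "z = y" using assms by simp
qed (fact assms)

lemma mult_unit_inv: "x dvd 1 \<Longrightarrow> x * unit_inv x = 1"
  by (metis dvdE unit_inv_unique)

text \<open>
  The canonical map from the rationals with odd denominator to the integers modulo 256; it is
  arbitrary on the other rationals. The lemmas below show that it does not depend on the chosen
  representation as a fraction and that it is a ring homomorphism.
\<close>

definition rat_mod256 :: "rat \<Rightarrow> 256" where
  "rat_mod256 x = (case quotient_of x of (r, s) \<Rightarrow> of_int r * unit_inv (of_int s))"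

lemma of_int_256: "(of_int 256 :: 256) = 0"
  by simp

lemma odd_unit_mod256:
  assumes "odd s"
  shows "(of_int s :: 256) dvd 1"
proof -
  have "coprime s (2 ^ 8)"
    using assms by (simp only: coprime_power_right_iff coprime_right_2_iff_odd simp_thms)
  then have "gcd s (2 ^ 8) = 1"
    by (rule coprime_imp_gcd_eq_1)
  moreover obtain u v where "u * s + v * 2 ^ 8 = gcd s (2 ^ 8)"
    using bezout_int[of s "2 ^ 8"] by blast
  ultimately have "u * s + v * 256 = 1"
    by simp
  then have "(of_int (u * s + v * 256) :: 256) = of_int 1"
    by (rule arg_cong)
  then have "of_int s * of_int u = (1 :: 256)"
    using of_int_256 by (simp add: mult.commute del: of_int_numeral)
  then show ?thesis
    by (metis dvdI)
qed

lemma rat_mod256_fraction: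
  assumes "odd s"
  shows "rat_mod256 (of_int r / of_int s) = of_int r * unit_inv (of_int s)"
proof -
  obtain m n where mn: "quotient_of (of_int r / of_int s) = (m, n)"
    by (cases "quotient_of (of_int r / of_int s)")
  have n0: "n > 0" and "coprime m n"
    using quotient_of_denom_pos[OF mn] quotient_of_coprime[OF mn] by auto
  have s0: "s \<noteq> 0"
    using assms by auto
  have "(of_int r / of_int s :: rat) = of_int m / of_int n"
    by (rule quotient_of_div[OF mn])
  then have "(of_int (r * n) :: rat) = of_int (m * s)"
    using n0 s0 by (simp add: field_simps)
  then have cross: "r * n = m * s"
    by (simp only: of_int_eq_iff)
  have "n dvd m * s"
    by (metis cross dvd_triv_right)
  then have "n dvd s"
    using \<open>coprime m n\<close> by (simp add: coprime_commute coprime_dvd_mult_right_iff)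
  then have "odd n"
    using assms by (meson dvd_trans)
  let ?n = "of_int n :: 256" and ?s = "of_int s :: 256"
  have n1: "?n * unit_inv ?n = 1" and s1: "?s * unit_inv ?s = 1"
    using \<open>odd n\<close> assms by (simp_all add: mult_unit_inv odd_unit_mod256)
  have "of_int r * ?n = (of_int m :: 256) * ?s"
    by (metis cross of_int_mult)
  then have "(of_int r * ?n) * (unit_inv ?n * unit_inv ?s) =
      (of_int m * ?s) * (unit_inv ?n * unit_inv ?s)"
    by (rule arg_cong)
  then have "of_int r * unit_inv ?s * (?n * unit_inv ?n) =
      of_int m * unit_inv ?n * (?s * unit_inv ?s)"
    by (simp only: ac_simps)
  then show ?thesis
    by (simp add: rat_mod256_def mn n1 s1)
qed

lemma unit_inv_mult:
  assumes "x dvd 1" and "y dvd 1"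
  shows "unit_inv (x * y) = unit_inv x * unit_inv y"
proof (rule unit_inv_unique)
  have "x * y * (unit_inv x * unit_inv y) = (x * unit_inv x) * (y * unit_inv y)"
    by (simp add: ac_simps)
  then show "x * y * (unit_inv x * unit_inv y) = 1"
    using assms by (simp add: mult_unit_inv)
qed

lemma rat_mod256_of_int: "rat_mod256 (of_int r) = of_int r"
  using rat_mod256_fraction[of 1 r] unit_inv_unique[of "1 :: 256" 1] by simp

lemma rat_mod256_hom:
  assumes "odd (snd (quotient_of x))" and "odd (snd (quotient_of y))"
  shows "rat_mod256 (x * y) = rat_mod256 x * rat_mod256 y"
    and "rat_mod256 (x + y) = rat_mod256 x + rat_mod256 y"
proof -
  obtain m n where mn: "quotient_of x = (m, n)" by (cases "quotient_of x")
  obtain k l where kl: "quotient_of y = (k, l)" by (cases "quotient_of y")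
  have x: "x = of_int m / of_int n" and y: "y = of_int k / of_int l"
    using quotient_of_div[OF mn] quotient_of_div[OF kl] by auto
  have odd: "odd n" "odd l" "odd (n * l)"
    using assms by (auto simp: mn kl)
  have nz: "n \<noteq> 0" "l \<noteq> 0"
    using odd by auto
  have prod: "x * y = of_int (m * k) / of_int (n * l)"
    by (simp add: x y)
  have plus: "x + y = of_int (m * l + k * n) / of_int (n * l)"
    using nz by (simp add: x y field_simps)
  have n1: "of_int n * unit_inv (of_int n) = (1 :: 256)"
    and l1: "of_int l * unit_inv (of_int l) = (1 :: 256)"
    using odd by (simp_all add: mult_unit_inv odd_unit_mod256)
  have inv: "unit_inv (of_int (n * l)) = unit_inv (of_int n) * (unit_inv (of_int l) :: 256)"
    using odd by (simp add: unit_inv_mult odd_unit_mod256)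
  have fx: "rat_mod256 x = of_int m * unit_inv (of_int n)"
    and fy: "rat_mod256 y = of_int k * unit_inv (of_int l)"
    by (simp_all add: rat_mod256_def mn kl)
  show "rat_mod256 (x * y) = rat_mod256 x * rat_mod256 y"
    unfolding prod rat_mod256_fraction[OF odd(3)] inv fx fy by (simp add: ac_simps)
  have "rat_mod256 (x + y) = of_int m * unit_inv (of_int n) * (of_int l * unit_inv (of_int l))
      + of_int k * unit_inv (of_int l) * (of_int n * unit_inv (of_int n))"
    unfolding plus rat_mod256_fraction[OF odd(3)] inv by (simp add: algebra_simps)
  then show "rat_mod256 (x + y) = rat_mod256 x + rat_mod256 y"
    by (simp add: n1 l1 fx fy)
qed

definition row_L :: "nat \<Rightarrow> (nat \<Rightarrow> 'a) \<Rightarrow> 'a mat" where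
  "row_L q \<alpha> = mat 1 (q - 1) (\<lambda>(i, j). \<alpha> (j + 1))"

definition mat_U :: "nat \<Rightarrow> 'a \<Rightarrow> (nat \<Rightarrow> 'a) \<Rightarrow> 'a::comm_ring_1 mat" where
  "mat_U q \<epsilon> \<alpha> = (let L = row_L q \<alpha> in
     four_block_mat
       (mat 1 1 (\<lambda>_. \<alpha> 0))              L
       (- \<epsilon> \<cdot>\<^sub>m transpose_mat L)   (1\<^sub>m (q - 1) - unit_inv (1 + \<epsilon> * \<alpha> 0) \<cdot>\<^sub>m (transpose_mat L * L)))"

end

theory Submission
  imports Defs
begin

text \<open>
  Writing \<open>\<Sum>b\<^sub>j\<^sup>2 = 4m + 1\<close>, a factor 2 cancels in every fraction: \<open>a\<^sub>0 = -2m/(2m+1)\<close> and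
  \<open>a\<^sub>k = b\<^sub>k/(2m+1)\<close>. This gives the parity claims; since \<open>(2m)\<^sup>2 + (4m+1) = (2m+1)\<^sup>2\<close> the vector
  \<open>(a\<^sub>0, \<dots>, a\<^bsub>q-1\<^esub>)\<close> has square norm 1, and \<open>1 \<plusminus> a\<^sub>0\<close> is a quotient of odd numbers, hence a unit
  modulo 256.

  Orthogonality then holds over any commutative ring, because \<open>U\<close> is a Householder reflection up to
  the sign of its first row. Put (as a row) \<open>v = (1 + \<epsilon>a\<^sub>0, \<epsilon>a\<^sub>1, \<dots>, \<epsilon>a\<^bsub>q-1\<^esub>)\<close> and
  \<open>t = (1 + \<epsilon>a\<^sub>0)\<^sup>-\<^sup>1\<close>. From
  \<open>\<Sum>a\<^sub>k\<^sup>2 = 1\<close> and \<open>\<epsilon>\<^sup>2 = 1\<close> one gets \<open>\<Sum>v\<^sub>k\<^sup>2 = 2(1 + \<epsilon>a\<^sub>0)\<close>, so \<open>I - t v\<^sup>Tv\<close> is the reflection in \<open>v\<close>,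
  and multiplying its first row by \<open>-\<epsilon>\<close> yields \<open>U\<close>. The argument lies in \<open>signed_reflection_orthogonal\<close>
  and \<open>mat_U_entry\<close>.
\<close>

section \<open>Signed reflections over a commutative ring\<close>

text \<open>
  For invertible \<open>v \<bullet> v\<close> the hypothesis \<open>norm\<close> says \<open>t = 2/(v \<bullet> v)\<close>. The product form is needed because
  modulo 256 the number \<open>v \<bullet> v\<close> is twice a unit, hence not invertible.
\<close>

lemma signed_reflection_orthogonal:
  fixes d v :: "nat \<Rightarrow> 'a::comm_ring_1"
  assumes sign: "\<And>i. i < n \<Longrightarrow> d i * d i = 1"
    and norm: "t * (\<Sum>k<n. v k * v k) = 2"
  defines "M \<equiv> mat n n (\<lambda>(i, j). d i * ((if i = j then 1 else 0) - t * v i * v j))"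
  shows "transpose_mat M * M = 1\<^sub>m n"
proof (rule eq_matI)
  fix i j
  assume "i < dim_row (1\<^sub>m n :: 'a mat)" and "j < dim_col (1\<^sub>m n :: 'a mat)"
  then have i: "i < n" and j: "j < n"
    by simp_all
  let ?\<delta> = "\<lambda>i j. if i = j then 1 else 0 :: 'a"
  have "(transpose_mat M * M) $$ (i, j) =
      (\<Sum>k<n. (d k * (?\<delta> k i - t * v k * v i)) * (d k * (?\<delta> k j - t * v k * v j)))"
    using i j by (simp add: M_def scalar_prod_def lessThan_atLeast0)
  also have "\<dots> = (\<Sum>k<n. (if k = i then ?\<delta> i j - t * v i * v j else 0)
      - (if k = j then t * v i * v j else 0) + t * t * v i * v j * (v k * v k))"
  proof (rule sum.cong[OF refl])
    fix k
    assume "k \<in> {..<n}"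
    then have dk: "d k * d k = 1"
      using sign by simp
    have "d k * x * (d k * y) = (d k * d k) * (x * y)" for x y
      by (simp only: ac_simps)
    then have "(d k * (?\<delta> k i - t * v k * v i)) * (d k * (?\<delta> k j - t * v k * v j)) =
        (?\<delta> k i - t * v k * v i) * (?\<delta> k j - t * v k * v j)"
      by (simp only: dk mult_1)
    also have "\<dots> = (if k = i then ?\<delta> i j - t * v i * v j else 0)
        - (if k = j then t * v i * v j else 0) + t * t * v i * v j * (v k * v k)"
      by (cases "k = i"; cases "k = j") (simp_all add: algebra_simps)
    finally show "(d k * (?\<delta> k i - t * v k * v i)) * (d k * (?\<delta> k j - t * v k * v j)) =
        (if k = i then ?\<delta> i j - t * v i * v j else 0)
        - (if k = j then t * v i * v j else 0) + t * t * v i * v j * (v k * v k)" .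
  qed
  also have "\<dots> = ?\<delta> i j - 2 * (t * v i * v j) + t * t * v i * v j * (\<Sum>k<n. v k * v k)"
    using i j by (simp add: sum.distrib sum_subtractf sum_distrib_left)
  also have "t * t * v i * v j * (\<Sum>k<n. v k * v k) = t * v i * v j * (t * (\<Sum>k<n. v k * v k))"
    by (simp add: ac_simps)
  also have "?\<delta> i j - 2 * (t * v i * v j) + \<dots> = ?\<delta> i j"
    by (simp add: norm)
  finally show "(transpose_mat M * M) $$ (i, j) = 1\<^sub>m n $$ (i, j)"
    using i j by simp
qed (simp_all add: M_def)

lemma mat_U_carrier:
  assumes "q \<ge> 1"
  shows "mat_U q \<epsilon> \<alpha> \<in> carrier_mat q q"
  using assms by (auto simp: mat_U_def row_L_def Let_def)

text \<open>
  The choice of \<open>v\<^sub>0\<close> gives \<open>t v\<^sub>0 = 1\<close>, so the first row and column of \<open>I - t v\<^sup>Tv\<close> are those of \<open>I\<close> minus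
  \<open>v\<close>; in the remaining block the two factors \<open>\<epsilon>\<close> in \<open>v\<^sub>i v\<^sub>j\<close> cancel. The factor \<open>-\<epsilon>\<close> turns the first row
  \<open>-\<epsilon>(a\<^sub>0, L)\<close> of the reflection into \<open>(a\<^sub>0, L)\<close>.
\<close>

lemma mat_U_entry:
  fixes \<epsilon> :: "'a::comm_ring_1" and \<alpha> :: "nat \<Rightarrow> 'a"
  assumes sign: "\<epsilon> * \<epsilon> = 1" and unit: "1 + \<epsilon> * \<alpha> 0 dvd 1"
    and i: "i < q" and j: "j < q"
  defines "v \<equiv> \<lambda>k. if k = 0 then 1 + \<epsilon> * \<alpha> 0 else \<epsilon> * \<alpha> k"
  shows "mat_U q \<epsilon> \<alpha> $$ (i, j) = (if i = 0 then - \<epsilon> else 1) *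
    ((if i = j then 1 else 0) - unit_inv (1 + \<epsilon> * \<alpha> 0) * v i * v j)"
proof -
  let ?t = "unit_inv (1 + \<epsilon> * \<alpha> 0)"
  have t: "?t * (1 + \<epsilon> * \<alpha> 0) = 1"
    using mult_unit_inv[OF unit] by (simp add: mult.commute)
  have cancel: "?t * (1 + \<epsilon> * \<alpha> 0) * x = x" "?t * x * (1 + \<epsilon> * \<alpha> 0) = x" for x
    using t by (simp, metis mult.commute mult.left_commute mult_1)
  have sq: "\<epsilon> * (\<epsilon> * x) = x" for x
    using sign by (metis mult.assoc mult_1)
  have sq': "?t * (\<epsilon> * x) * (\<epsilon> * y) = ?t * (x * y)" for x y
    using sq[of "?t * (x * y)"] by (simp add: ac_simps)
  show ?thesis
  proof (cases "i = 0")
    case True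
    have "?t * v i * v j = v j"
      using True by (simp add: v_def cancel)
    then show ?thesis
      using True j
      by (auto simp: mat_U_def row_L_def Let_def v_def sq right_diff_distrib distrib_left)
  next
    case False
    have "mat_U q \<epsilon> \<alpha> $$ (i, j) =
        (if j = 0 then - \<epsilon> * \<alpha> i else (if i = j then 1 else 0) - ?t * (\<alpha> i * \<alpha> j))"
      using False i j by (auto simp: mat_U_def row_L_def Let_def scalar_prod_def)
    then show ?thesis
      using False by (simp add: v_def cancel sq')
  qed
qed

lemma mat_U_orthogonal:
  fixes \<epsilon> :: "'a::comm_ring_1" and \<alpha> :: "nat \<Rightarrow> 'a"
  assumes q: "q \<ge> 1" and sign: "\<epsilon> * \<epsilon> = 1" and unit: "1 + \<epsilon> * \<alpha> 0 dvd 1"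
    and norm: "\<alpha> 0 * \<alpha> 0 + (\<Sum>k = 1..<q. \<alpha> k * \<alpha> k) = 1"
  shows "transpose_mat (mat_U q \<epsilon> \<alpha>) * mat_U q \<epsilon> \<alpha> = 1\<^sub>m q"
proof -
  define t where "t = unit_inv (1 + \<epsilon> * \<alpha> 0)"
  define v where "v = (\<lambda>k. if k = 0 then 1 + \<epsilon> * \<alpha> 0 else \<epsilon> * \<alpha> k)"
  define d where "d = (\<lambda>i::nat. if i = 0 then - \<epsilon> else 1)"
  have t: "t * (1 + \<epsilon> * \<alpha> 0) = 1"
    unfolding t_def using mult_unit_inv[OF unit] by (simp add: mult.commute)
  have sq: "\<epsilon> * x * (\<epsilon> * x) = x * x" for x
  proof -
    have "\<epsilon> * x * (\<epsilon> * x) = (\<epsilon> * \<epsilon>) * (x * x)" by (simp only: ac_simps)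
    then show ?thesis by (simp add: sign)
  qed
  have "(\<Sum>k<q. v k * v k) = v 0 * v 0 + (\<Sum>k = 1..<q. v k * v k)"
    using q by (simp add: lessThan_atLeast0 sum.atLeast_Suc_lessThan)
  also have "(\<Sum>k = 1..<q. v k * v k) = (\<Sum>k = 1..<q. \<alpha> k * \<alpha> k)"
    by (rule sum.cong) (auto simp: v_def sq)
  also have "\<dots> = 1 - \<alpha> 0 * \<alpha> 0"
    using norm by (simp add: algebra_simps)
  also have "v 0 * v 0 + (1 - \<alpha> 0 * \<alpha> 0) = 2 * (1 + \<epsilon> * \<alpha> 0)"
    using sq[of "\<alpha> 0"] by (simp add: v_def distrib_left distrib_right)
  finally have "t * (\<Sum>k<q. v k * v k) = 2 * (t * (1 + \<epsilon> * \<alpha> 0))"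
    by (simp only: mult.left_commute)
  then have v_norm: "t * (\<Sum>k<q. v k * v k) = 2"
    by (simp only: t mult_1_right)
  have "mat_U q \<epsilon> \<alpha> = mat q q (\<lambda>(i, j). d i * ((if i = j then 1 else 0) - t * v i * v j))"
    using mat_U_carrier[OF q, of \<epsilon> \<alpha>] mat_U_entry[where \<alpha> = \<alpha>, OF sign unit]
    by (intro eq_matI) (auto simp: d_def v_def t_def)
  moreover have "d i * d i = 1" for i
    by (simp add: d_def sign)
  ultimately show ?thesis
    using signed_reflection_orthogonal[of q d t v] v_norm by simp
qed

section \<open>Fractions with odd denominator\<close>

lemma quotient_of_fraction_parity:
  assumes "odd s"
  shows "odd (snd (quotient_of (of_int r / of_int s)))"
    and "even (fst (quotient_of (of_int r / of_int s))) \<longleftrightarrow> even r"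
proof -
  obtain m n where mn: "quotient_of (of_int r / of_int s) = (m, n)"
    by (cases "quotient_of (of_int r / of_int s)")
  have nz: "n > 0" "s \<noteq> 0" and "coprime m n"
    using quotient_of_denom_pos[OF mn] quotient_of_coprime[OF mn] assms by auto
  have "(of_int (r * n) :: rat) = of_int (m * s)"
    using quotient_of_div[OF mn] nz by (simp add: field_simps)
  then have cross: "r * n = m * s"
    by (simp only: of_int_eq_iff)
  have "\<not> (even m \<and> even n)"
    using \<open>coprime m n\<close> by (metis coprime_common_divisor odd_one)
  then show "odd (snd (quotient_of (of_int r / of_int s)))"
    and "even (fst (quotient_of (of_int r / of_int s))) \<longleftrightarrow> even r"
    using arg_cong[OF cross, of even] assms by (auto simp: mn)
qed

section \<open>The rational unit vector\<close>

theorem mainTheorem3: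
  fixes q :: nat and b :: "nat \<Rightarrow> int" and a :: "nat \<Rightarrow> rat"
  assumes "q \<ge> 2"
    and "\<forall>j\<in>{1..<q}. b j \<in> {0..255}"
    and "[(\<Sum>j = 1..<q. (b j)\<^sup>2) = 1] (mod 4)"
    and "a 0 = (1 - (\<Sum>j = 1..<q. (of_int (b j))\<^sup>2)) / (1 + (\<Sum>j = 1..<q. (of_int (b j))\<^sup>2))"
    and "\<forall>k\<in>{1..<q}. a k = 2 * of_int (b k) / (1 + (\<Sum>j = 1..<q. (of_int (b j))\<^sup>2))"
  shows "(\<forall>k<q. odd (snd (quotient_of (a k)))) \<and>
    even (fst (quotient_of (a 0))) \<and>
    (\<forall>\<epsilon>\<in>{1, -1 :: 256}.
       1 + \<epsilon> * rat_mod256 (a 0) dvd 1 \<and>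
       mat_U q \<epsilon> (\<lambda>k. rat_mod256 (a k)) \<in> carrier_mat q q \<and>
       transpose_mat (mat_U q \<epsilon> (\<lambda>k. rat_mod256 (a k))) * mat_U q \<epsilon> (\<lambda>k. rat_mod256 (a k)) = 1\<^sub>m q)"
proof -
  let ?S = "\<Sum>j = 1..<q. (b j)\<^sup>2"
  define m where "m = ?S div 4"
  define w where "w = 2 * m + 1"
  have "?S mod 4 = 1"
    using assms(3) by (simp add: cong_def)
  then have S: "?S = 4 * m + 1"
    using div_mult_mod_eq[of ?S 4] by (simp add: m_def)
  have w: "odd w"
    by (simp add: w_def)
  have "(\<Sum>j = 1..<q. (of_int (b j))\<^sup>2 :: rat) = of_int ?S"
    by simp
  then have Sr: "(\<Sum>j = 1..<q. (of_int (b j))\<^sup>2 :: rat) = of_int (4 * m + 1)"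
    by (simp only: S)
  have denom: "1 + (of_int (4 * m + 1) :: rat) = 2 * of_int w"
    by (simp add: w_def)
  \<comment> \<open>The numerators after cancelling the common factor 2.\<close>
  define r where "r = (\<lambda>k. if k = 0 then - (2 * m) else b k)"
  have a: "a k = of_int (r k) / of_int w" if "k < q" for k
  proof (cases "k = 0")
    case True
    have "1 - (of_int (4 * m + 1) :: rat) = 2 * of_int (r 0)"
      by (simp add: r_def)
    then have "a 0 = (2 * of_int (r 0)) / (2 * of_int w)"
      using assms(4) by (simp only: Sr denom)
    then show ?thesis
      using True by simp
  next
    case False
    then have "a k = 2 * of_int (b k) / (2 * of_int w)"
      using assms(5) that by (simp only: Sr denom) simp
    then show ?thesis
      using False by (simp add: r_def)
  qed
  have odd_denom: "\<forall>k<q. odd (snd (quotient_of (a k)))"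
    using quotient_of_fraction_parity(1)[OF w] by (simp add: a)
  have even_num: "even (fst (quotient_of (a 0)))"
    using quotient_of_fraction_parity(2)[OF w, of "r 0"] a[of 0] assms(1) by (simp add: r_def)

  define \<alpha> where "\<alpha> = (\<lambda>k. rat_mod256 (a k))"
  define u :: 256 where "u = unit_inv (of_int w)"
  have u: "of_int w * u = 1"
    unfolding u_def by (rule mult_unit_inv[OF odd_unit_mod256[OF w]])
  have \<alpha>: "\<alpha> k = of_int (r k) * u" if "k < q" for k
    using rat_mod256_fraction[OF w] a[OF that] by (simp add: \<alpha>_def u_def)
  have \<alpha>0: "\<alpha> 0 = of_int (r 0) * u"
    using \<alpha> assms(1) by simp
  have norm: "\<alpha> 0 * \<alpha> 0 + (\<Sum>k = 1..<q. \<alpha> k * \<alpha> k) = 1"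
  proof -
    have "(\<Sum>k = 1..<q. \<alpha> k * \<alpha> k) = (\<Sum>k = 1..<q. of_int ((b k)\<^sup>2) * (u * u))"
      by (rule sum.cong) (auto simp: \<alpha> r_def power2_eq_square ac_simps)
    also have "\<dots> = of_int ?S * (u * u)"
      by (simp only: of_int_sum sum_distrib_right)
    finally have "\<alpha> 0 * \<alpha> 0 + (\<Sum>k = 1..<q. \<alpha> k * \<alpha> k) = of_int (r 0 * r 0 + ?S) * (u * u)"
      unfolding \<alpha>0 by (simp only: of_int_add of_int_mult distrib_left distrib_right ac_simps)
    also have "r 0 * r 0 + ?S = w * w"
      unfolding S by (simp add: r_def w_def algebra_simps)
    also have "of_int (w * w) * (u * u) = (of_int w * u) * (of_int w * u)"
      by (simp only: of_int_mult ac_simps)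
    finally show ?thesis
      by (simp add: u)
  qed
  have unit: "1 + \<epsilon> * \<alpha> 0 dvd 1" if "\<epsilon> \<in> {1, -1}" for \<epsilon> :: 256
  proof -
    \<comment> \<open>As \<open>1 + \<epsilon>a\<^sub>0 = (w + \<epsilon>r\<^sub>0)/w\<close> with \<open>r\<^sub>0\<close> even, numerator and denominator are odd; an integer
      representative of \<open>\<epsilon>\<close> is needed to speak of parity.\<close>
    define e :: int where "e = (if \<epsilon> = 1 then 1 else -1)"
    have e: "\<epsilon> = of_int e"
      using that by (auto simp: e_def)
    have "of_int (w + e * r 0) * u = of_int w * u + \<epsilon> * \<alpha> 0"
      unfolding \<alpha>0 e by (simp only: of_int_add of_int_mult distrib_right mult.assoc)
    then have "1 + \<epsilon> * \<alpha> 0 = of_int (w + e * r 0) * u"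
      by (simp only: u)
    moreover have "odd (w + e * r 0)"
      using w by (simp add: r_def)
    moreover have "u dvd 1"
      using u by (metis dvd_triv_right)
    ultimately show ?thesis
      using mult_dvd_mono[OF odd_unit_mod256, of "w + e * r 0" u 1] by simp
  qed
  have "1 + \<epsilon> * \<alpha> 0 dvd 1 \<and> mat_U q \<epsilon> \<alpha> \<in> carrier_mat q q \<and>
      transpose_mat (mat_U q \<epsilon> \<alpha>) * mat_U q \<epsilon> \<alpha> = 1\<^sub>m q" if "\<epsilon> \<in> {1, -1}" for \<epsilon> :: 256
  proof -
    have "q \<ge> 1" and "\<epsilon> * \<epsilon> = 1"
      using assms(1) that by auto
    then show ?thesis
      using unit[OF that] mat_U_carrier mat_U_orthogonal norm by blast
  qed
  then show ?thesis
    using odd_denom even_num unfolding \<alpha>_def by blast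
qed

end
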